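(* For every constant $\epsilon>0$ there exists a principal-agent problem $(\mathbf c,\mathbf F,\mathbf r)$ with $n=3$ actions such that $\mathrm{OptSingle}(\mathbf c,\mathbf F,\mathbf r)>0$ and $$\frac{\mathrm{OptMenu}(\mathbf c,\mathbf F,\mathbf r)}{\mathrm{OptSingle}(\mathbf c,\mathbf F,\mathbf r)}\ \ge\ 2-\epsilon.$$
   Context: A (typed) principal-agent problem $(\mathbf c,\mathbf F,\mathbf r)$ with $n$ actions, $m$ outcomes and $T$ types consists of: costs $\mathbf c\in\mathbb R_{\ge 0}^n$ (the same for all types), where some action has cost $0$; rewards $\mathbf r\in\mathbb R_{\ge0}^m$, where some outcome has reward $0$ (the ordering of actions and outcomes is immaterial); and, for each type $t\in[T]$ and action $i\in[n]$, a probability distribution $(F^{(t)}_{i,j})_{j\in[m]}$ over outcomes. The agent's type is uniform on $[T]$; $\mathbb E_t$ denotes the expectation over it. A contract is a vector $\mathbf x\in\mathbb R_{\ge0}^m$. Under $\mathbf x$, an agent of type $t$ plays an action $i_*^{(t)}(\mathbf x)\in\arg\max_i\big(\sum_j F^{(t)}_{i,j}x_j-c_i\big)$, ties being broken so as to maximize the principal's profit $\mathrm{Profit}^{(t)}(\mathbf x)=\sum_j F^{(t)}_{i_*^{(t)}(\mathbf x),j}(r_j-x_j)$. $\mathrm{OptSingle}=\max_{\mathbf x}\mathbb E_t[\mathrm{Profit}^{(t)}(\mathbf x)]$. A menu $X=(\mathbf x^{(1)},\dots,\mathbf x^{(T)})$ assigns one contract per type; it is incentive-compatible (IC) if for all $t,t'\in[T]$: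 $\max_i\big(\sum_jF^{(t)}_{i,j}x^{(t)}_j-c_i\big)\ge\max_i\big(\sum_jF^{(t)}_{i,j}x^{(t')}_j-c_i\big)$. $\mathrm{OptMenu}$ is the maximum of $\mathbb E_t[\mathrm{Profit}^{(t)}(\mathbf x^{(t)})]$ over IC menus. *)

theory Defs
  imports Complex_Main
begin

text \<open>
  Actions, outcomes and types are numbered from 0. The functions in the record only matter
  for indices below the respective bounds; the same holds for contracts and menus.
\<close>

record pa_problem =
  n_actions :: nat
  n_outcomes :: nat
  n_types :: nat
  cost :: "nat \<Rightarrow> real"
  outcome_prob :: "nat \<Rightarrow> nat \<Rightarrow> nat \<Rightarrow> real"  \<comment> \<open>type, action, outcome\<close>
  reward :: "nat \<Rightarrow> real"

definition principal_agent_problem :: "pa_problem \<Rightarrow> bool" where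
  "principal_agent_problem P \<longleftrightarrow>
     n_types P > 0 \<and>
     (\<forall>i<n_actions P. cost P i \<ge> 0) \<and> (\<exists>i<n_actions P. cost P i = 0) \<and>
     (\<forall>j<n_outcomes P. reward P j \<ge> 0) \<and> (\<exists>j<n_outcomes P. reward P j = 0) \<and>
     (\<forall>t<n_types P. \<forall>i<n_actions P.
        (\<forall>j<n_outcomes P. outcome_prob P t i j \<ge> 0) \<and>
        (\<Sum>j<n_outcomes P. outcome_prob P t i j) = 1)"

definition expect_type :: "pa_problem \<Rightarrow> (nat \<Rightarrow> real) \<Rightarrow> real" where
  "expect_type P f = (\<Sum>t<n_types P. f t) / real (n_types P)"

definition contract :: "pa_problem \<Rightarrow> (nat \<Rightarrow> real) \<Rightarrow> bool" where
  "contract P x \<longleftrightarrow> (\<forall>j<n_outcomes P. x j \<ge> 0)"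

definition agent_utility :: "pa_problem \<Rightarrow> nat \<Rightarrow> (nat \<Rightarrow> real) \<Rightarrow> nat \<Rightarrow> real" where
  "agent_utility P t x i = (\<Sum>j<n_outcomes P. outcome_prob P t i j * x j) - cost P i"

definition principal_payoff :: "pa_problem \<Rightarrow> nat \<Rightarrow> (nat \<Rightarrow> real) \<Rightarrow> nat \<Rightarrow> real" where
  "principal_payoff P t x i = (\<Sum>j<n_outcomes P. outcome_prob P t i j * (reward P j - x j))"

definition best_responses :: "pa_problem \<Rightarrow> nat \<Rightarrow> (nat \<Rightarrow> real) \<Rightarrow> nat set" where
  "best_responses P t x = {i. is_arg_max (agent_utility P t x) (\<lambda>i. i < n_actions P) i}"

definition chosen_action :: "pa_problem \<Rightarrow> nat \<Rightarrow> (nat \<Rightarrow> real) \<Rightarrow> nat" where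
  "chosen_action P t x = (ARG_MAX (principal_payoff P t x) i. i \<in> best_responses P t x)"

definition profit :: "pa_problem \<Rightarrow> nat \<Rightarrow> (nat \<Rightarrow> real) \<Rightarrow> real" where
  "profit P t x = principal_payoff P t x (chosen_action P t x)"

definition incentive_compatible :: "pa_problem \<Rightarrow> (nat \<Rightarrow> nat \<Rightarrow> real) \<Rightarrow> bool" where
  "incentive_compatible P X \<longleftrightarrow>
     (\<forall>t<n_types P. \<forall>t'<n_types P.
        (MAX i\<in>{..<n_actions P}. agent_utility P t (X t) i)
          \<ge> (MAX i\<in>{..<n_actions P}. agent_utility P t (X t') i))"

definition ic_menu :: "pa_problem \<Rightarrow> (nat \<Rightarrow> nat \<Rightarrow> real) \<Rightarrow> bool" where
  "ic_menu P X \<longleftrightarrow> (\<forall>t<n_types P. contract P (X t)) \<and> incentive_compatible P X"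

text \<open>
  The two optima below are maxima, written as suprema of sets of reals. The sets are nonempty
  (zero contract) and bounded above (lemmas below). The suprema are attained: for each fixed
  assignment of actions to types the problem is a linear program with bounded objective, and
  there are finitely many assignments.
\<close>

definition opt_single :: "pa_problem \<Rightarrow> real" where
  "opt_single P = (SUP x\<in>{x. contract P x}. expect_type P (\<lambda>t. profit P t x))"

definition opt_menu :: "pa_problem \<Rightarrow> real" where
  "opt_menu P = (SUP X\<in>{X. ic_menu P X}. expect_type P (\<lambda>t. profit P t (X t)))"

lemma chosen_action:
  assumes "principal_agent_problem P"
  shows "is_arg_max (principal_payoff P t x) (\<lambda>i. i \<in> best_responses P t x) (chosen_action P t x)"
proof -
  have ex: "\<exists>i. is_arg_max f (\<lambda>i. i \<in> A) i" if "finite A" "A \<noteq> {}" for f :: "nat \<Rightarrow> real" and A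
  proof -
    have "Max (f ` A) \<in> f ` A"
      using that by (intro Max_in) auto
    then obtain i where "i \<in> A" "f i = Max (f ` A)"
      by (elim imageE) simp
    then have "is_arg_max f (\<lambda>i. i \<in> A) i"
      using that by (simp add: is_arg_max_linorder)
    then show ?thesis ..
  qed
  have "{..<n_actions P} \<noteq> {}"
    using assms by (auto simp: principal_agent_problem_def)
  then have "best_responses P t x \<noteq> {}"
    using ex[of "{..<n_actions P}"] by (auto simp: best_responses_def)
  moreover have "finite (best_responses P t x)"
    by (rule finite_subset[of _ "{..<n_actions P}"]) (auto simp: best_responses_def is_arg_max_def)
  ultimately have "\<exists>i. is_arg_max (principal_payoff P t x) (\<lambda>i. i \<in> best_responses P t x) i"
    by (intro ex)
  from someI_ex[OF this] show ?thesis
    by (simp only: chosen_action_def arg_max_def)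
qed

lemma profit_le:
  assumes P: "principal_agent_problem P" and x: "contract P x" and t: "t < n_types P"
  shows "profit P t x \<le> (\<Sum>j<n_outcomes P. reward P j)"
proof -
  define i where "i = chosen_action P t x"
  have i: "i < n_actions P"
    using chosen_action[OF P, of t x] by (auto simp: i_def best_responses_def is_arg_max_def)
  have "outcome_prob P t i j * (reward P j - x j) \<le> reward P j" if j: "j < n_outcomes P" for j
  proof -
    have nn: "\<And>k. k < n_outcomes P \<Longrightarrow> outcome_prob P t i k \<ge> 0"
      and s: "(\<Sum>k<n_outcomes P. outcome_prob P t i k) = 1"
      using P t i by (auto simp: principal_agent_problem_def)
    have "outcome_prob P t i j \<le> 1"
      using member_le_sum[of j "{..<n_outcomes P}" "outcome_prob P t i"] nn j s by auto
    moreover have "reward P j \<ge> 0" "x j \<ge> 0"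
      using P x j by (auto simp: principal_agent_problem_def contract_def)
    ultimately have "outcome_prob P t i j * (reward P j - x j) \<le> outcome_prob P t i j * reward P j"
      "outcome_prob P t i j * reward P j \<le> reward P j"
      using nn[OF j] by (auto intro: mult_left_mono mult_left_le_one_le)
    then show ?thesis by linarith
  qed
  then show ?thesis
    unfolding profit_def principal_payoff_def i_def[symmetric] by (intro sum_mono) auto
qed

lemma expect_type_le:
  assumes P: "principal_agent_problem P" and f: "\<And>t. t < n_types P \<Longrightarrow> f t \<le> B"
  shows "expect_type P f \<le> B"
proof -
  have "(\<Sum>t<n_types P. f t) \<le> real (n_types P) * B"
    using sum_bounded_above[of "{..<n_types P}" f B] f by simp
  moreover have "n_types P > 0"
    using P by (simp add: principal_agent_problem_def)
  ultimately show ?thesis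
    by (simp add: expect_type_def pos_divide_le_eq mult.commute)
qed

lemma bdd_above_single:
  assumes P: "principal_agent_problem P"
  shows "bdd_above ((\<lambda>x. expect_type P (\<lambda>t. profit P t x)) ` {x. contract P x})"
proof (rule bdd_aboveI2)
  fix x assume "x \<in> {x. contract P x}"
  then show "expect_type P (\<lambda>t. profit P t x) \<le> (\<Sum>j<n_outcomes P. reward P j)"
    by (intro expect_type_le[OF P] profit_le[OF P]) simp_all
qed

lemma bdd_above_menu:
  assumes P: "principal_agent_problem P"
  shows "bdd_above ((\<lambda>X. expect_type P (\<lambda>t. profit P t (X t))) ` {X. ic_menu P X})"
proof (rule bdd_aboveI2)
  fix X assume "X \<in> {X. ic_menu P X}"
  then show "expect_type P (\<lambda>t. profit P t (X t)) \<le> (\<Sum>j<n_outcomes P. reward P j)"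
    by (intro expect_type_le[OF P] profit_le[OF P]) (simp_all add: ic_menu_def)
qed

end

theory Submission
  imports Defs "HOL-Analysis.Harmonic_Numbers"
begin

text \<open>
  The paper's bound is reached, for all \<open>\<epsilon>\<close> at once, by one problem with ratio at least 2. There
  are \<open>K\<close> types, worthless outcomes \<open>0, \<dots>, K - 1\<close>, and one valuable outcome \<open>K\<close> of small
  probability. Working (action 1) costs 1; it produces expected reward \<open>1 + 1 / (t + 1)\<close> for
  type \<open>t\<close> and otherwise leads to outcome \<open>t\<close>. Shirking (actions 0 and 2, which are identical)
  leads to a uniformly random worthless outcome. A menu that pays type \<open>t\<close> only on outcome \<open>t\<close>
  gives a shirker next to nothing, so it extracts almost the whole surplus, the harmonic sum over
  the types. A single contract that pays on many worthless outcomes also rewards shirking, so it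
  must mostly pay on the valuable outcome; that amounts to a linear contract, and the surpluses
  \<open>1 / (t + 1)\<close> form an equal-revenue distribution, against which linear contracts earn a bounded
  total.
\<close>

section \<open>The problem, its utilities and its payoffs\<close>

definition type_reward :: "nat \<Rightarrow> real" where
  "type_reward t = 1 + 1 / (real t + 1)"

text \<open>The factor \<open>2 * real K\<close> cancels between the probability and the reward of
  outcome \<open>K\<close>. As \<open>type_reward t \<le> 2\<close>, a worker misses outcome
  \<open>t\<close> with probability at most \<open>1 / real K\<close>.\<close>

definition gap_problem :: "nat \<Rightarrow> pa_problem" where
  "gap_problem K =
    \<lparr>n_actions = 3, n_outcomes = Suc K, n_types = K,
     cost = (\<lambda>i. if i = 1 then 1 else 0),
     outcome_prob = (\<lambda>t i j.
       if i = 1 then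
         if j = K then type_reward t / (2 * real K)
         else if j = t then 1 - type_reward t / (2 * real K) else 0
       else if j < K then 1 / real K else 0),
     reward = (\<lambda>j. if j = K then 2 * real K else 0)\<rparr>"

lemma gap_problem_sizes [simp]:
  "n_actions (gap_problem K) = 3" "n_outcomes (gap_problem K) = Suc K" "n_types (gap_problem K) = K"
  by (simp_all add: gap_problem_def)

lemma type_reward_bounds: "1 \<le> type_reward t" "type_reward t \<le> 2"
  by (simp_all add: type_reward_def divide_simps)

lemma work_prob_bounds:
  assumes "K > 0"
  shows "0 \<le> type_reward t / (2 * real K)" "type_reward t / (2 * real K) \<le> 1 / real K"
    "type_reward t / (2 * real K) \<le> 1"
proof -
  have K: "real K \<ge> 1"
    using assms by linarith
  show "0 \<le> type_reward t / (2 * real K)"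
    using type_reward_bounds[of t] by simp
  show le: "type_reward t / (2 * real K) \<le> 1 / real K"
    using type_reward_bounds[of t] K by (simp add: divide_simps)
  have "1 / real K \<le> 1"
    using K by simp
  with le show "type_reward t / (2 * real K) \<le> 1"
    by linarith
qed

lemma principal_agent_problem_gap_problem:
  assumes "K > 0"
  shows "principal_agent_problem (gap_problem K)"
proof -
  have "(\<Sum>j<Suc K. outcome_prob (gap_problem K) t i j) = 1" if "t < K" for t i
    using that assms by (auto simp: gap_problem_def)
  moreover have "outcome_prob (gap_problem K) t i j \<ge> 0" for t i j
    using work_prob_bounds[OF assms] by (auto simp: gap_problem_def)
  ultimately show ?thesis
    using assms unfolding principal_agent_problem_def
    by (auto simp: gap_problem_def intro: exI[of _ "0::nat"])
qed

lemma agent_utility_gap_problem: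
  assumes "t < K"
  shows "agent_utility (gap_problem K) t x i =
    (if i = 1 then type_reward t / (2 * real K) * x K + (1 - type_reward t / (2 * real K)) * x t - 1
     else (\<Sum>j<K. x j) / real K)"
proof -
  have "(\<Sum>j<K. (if j = K then p else if j = t then q else 0) * x j) = q * x t" for p q
  proof -
    have "(\<Sum>j<K. (if j = K then p else if j = t then q else 0) * x j) =
        (\<Sum>j<K. if j = t then q * x t else 0)"
      by (intro sum.cong) auto
    then show ?thesis
      using assms by simp
  qed
  then show ?thesis
    by (auto simp: agent_utility_def gap_problem_def sum_divide_distrib)
qed

lemma principal_payoff_gap_problem:
  assumes "t < K"
  shows "principal_payoff (gap_problem K) t x i =
    (if i = 1 then type_reward t * (1 - x K / (2 * real K)) - (1 - type_reward t / (2 * real K)) * x t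
     else - (\<Sum>j<K. x j) / real K)"
proof -
  have "(\<Sum>j<K. (if j = K then p else if j = t then q else 0) *
      ((if j = K then 2 * real K else 0) - x j)) = - q * x t" for p q
  proof -
    have "(\<Sum>j<K. (if j = K then p else if j = t then q else 0) *
          ((if j = K then 2 * real K else 0) - x j)) =
        (\<Sum>j<K. if j = t then - q * x t else 0)"
      by (intro sum.cong) auto
    then show ?thesis
      using assms by simp
  qed
  moreover have "type_reward t / (2 * real K) * (2 * real K - x K) =
      type_reward t * (1 - x K / (2 * real K))"
    using assms by (simp add: field_simps)
  ultimately show ?thesis
    by (auto simp: principal_payoff_def gap_problem_def sum_divide_distrib sum_negf)
qed

text \<open>Ties favour the principal, so any single best response bounds the profit from below,
  without computing \<open>chosen_action\<close>.\<close>

lemma principal_payoff_le_profit: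
  assumes "principal_agent_problem P" "i \<in> best_responses P t x"
  shows "principal_payoff P t x i \<le> profit P t x"
  using chosen_action[OF assms(1), of t x] assms(2)
  by (simp add: profit_def is_arg_max_linorder)

section \<open>Single contracts: upper bound and positivity\<close>

text \<open>
  Here \<open>b\<close> is the principal's share of the reward, \<open>S\<close> the set of working types, \<open>y t\<close> the expected
  pay of type \<open>t\<close> on outcome \<open>t\<close>, and \<open>z\<close> a shirker's pay. If \<open>b\<close> is not tiny, the working types \<open>L\<close>
  with surplus below \<open>b / 3\<close> need so much pay on worthless outcomes that what they bring in is at
  most what the shirkers cost; every other working type contributes at most \<open>2 * b\<close>, and there are
  at most \<open>3 / b\<close> of these.
\<close>

lemma single_total_le:
  fixes y :: "nat \<Rightarrow> real" and b z :: real
  assumes K: "K > 0" and S: "S \<subseteq> {..<K}"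
    and y0: "\<And>t. t \<in> S \<Longrightarrow> y t \<ge> 0" and z0: "z \<ge> 0"
    and yz: "(\<Sum>t\<in>S. y t) \<le> real K * z"
    and work: "\<And>t. t \<in> S \<Longrightarrow> y t \<ge> z + b * type_reward t - 1 / (real t + 1)"
  shows "(\<Sum>t\<in>S. b * type_reward t - y t) - real (card ({..<K} - S)) * z \<le> 12"
\<comment> \<open>Below this threshold each worker brings in at most \<open>12 / real K\<close>;
  above it, \<open>3 / b\<close> is at most \<open>real K / 2\<close>, which makes
  \<open>half\<close> work.\<close>
proof (cases "b < 6 / real K")
  case True
  have "(\<Sum>t\<in>S. b * type_reward t - y t) \<le> real (card S) * (12 / real K)"
  proof (rule sum_bounded_above)
    fix t assume t: "t \<in> S"
    have "b * type_reward t \<le> 6 / real K * type_reward t"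
      using True type_reward_bounds(1)[of t] by (intro mult_right_mono) auto
    also have "\<dots> \<le> 6 / real K * 2"
      using type_reward_bounds(2)[of t] by (intro mult_left_mono) auto
    finally show "b * type_reward t - y t \<le> 12 / real K"
      using y0[OF t] by simp
  qed
  also have "\<dots> \<le> real K * (12 / real K)"
    using card_mono[OF _ S] by (intro mult_right_mono) auto
  also have "\<dots> = 12"
    using K by simp
  finally show ?thesis
    using z0 by (smt (verit) mult_nonneg_nonneg of_nat_0_le_iff)
next
  case False
  have fS: "finite S"
    using S finite_subset by blast
  have b0: "b > 0" "b * real K \<ge> 6"
    using False K by (auto simp: field_simps not_less intro: less_le_trans[of 0 "6 / real K"])
  define G where "G = {t\<in>S. (real t + 1) * b \<le> 3}"
  define L where "L = S - G"
  have GL: "S = G \<union> L" "G \<inter> L = {}" "finite G" "finite L"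
    using fS by (auto simp: G_def L_def)
  have split: "(\<Sum>t\<in>S. f t) = (\<Sum>t\<in>G. f t) + (\<Sum>t\<in>L. f t)" for f :: "nat \<Rightarrow> real"
    using GL by (simp add: sum.union_disjoint)
  have cardG: "real (card G) * b \<le> 3"
  proof (cases "G = {}")
    case nonempty: False
    have "card G \<le> Suc (Max G)"
      using card_mono[of "{..Max G}" G] GL(3) Max_ge[OF GL(3)] by (simp add: subset_iff)
    then have "real (card G) \<le> real (Max G) + 1"
      by linarith
    then have "real (card G) * b \<le> (real (Max G) + 1) * b"
      using b0(1) by (intro mult_right_mono) auto
    also have "\<dots> \<le> 3"
      using Max_in[OF GL(3) nonempty] unfolding G_def by blast
    finally show ?thesis .
  qed simp
  have half: "2 * real (card G) \<le> real K"
  proof -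
    have "b * (2 * real (card G)) \<le> b * real K"
      using cardG b0(2) by argo
    then show ?thesis
      using b0(1) by (rule mult_left_le_imp_le)
  qed
  have "(\<Sum>t\<in>G. b * type_reward t - y t) \<le> real (card G) * (2 * b) - (\<Sum>t\<in>G. y t)"
  proof -
    have "(\<Sum>t\<in>G. b * type_reward t) \<le> real (card G) * (2 * b)"
      using b0 type_reward_bounds(2) by (intro sum_bounded_above) auto
    then show ?thesis
      by (simp add: sum_subtractf)
  qed
  \<comment> \<open>On \<open>L\<close> the surplus is at most a third of
    \<open>b * type_reward t\<close>, so \<open>work\<close> gives
    \<open>y t \<ge> z + 2 / 3 * b * type_reward t\<close>.\<close>
  moreover have "(\<Sum>t\<in>L. b * type_reward t - y t) \<le> (\<Sum>t\<in>L. y t / 2 - 3 / 2 * z)"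
  proof (rule sum_mono)
    fix t assume t: "t \<in> L"
    then have "(real t + 1) * b > 3" "t \<in> S"
      by (auto simp: L_def G_def)
    then have "1 / (real t + 1) \<le> b / 3"
      by (simp add: field_simps)
    moreover have "b \<le> b * type_reward t"
      using b0 type_reward_bounds(1)[of t] by simp
    ultimately show "b * type_reward t - y t \<le> y t / 2 - 3 / 2 * z"
      using work[OF \<open>t \<in> S\<close>] by argo
  qed
  moreover have "(\<Sum>t\<in>L. y t / 2 - 3 / 2 * z) = (\<Sum>t\<in>L. y t) / 2 - 3 / 2 * (real (card L) * z)"
    by (simp add: sum_subtractf sum_divide_distrib)
  moreover have "(\<Sum>t\<in>G. y t) \<ge> 0"
    using y0 by (intro sum_nonneg) (auto simp: G_def)
  moreover have "real (card ({..<K} - S)) * z = real K * z - real (card G) * z - real (card L) * z"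
  proof -
    have "card S \<le> K"
      using card_mono[OF _ S] by simp
    then have "real (card ({..<K} - S)) = real K - real (card G) - real (card L)"
      using S fS GL by (simp add: card_Diff_subset card_Un_disjoint)
    then show ?thesis
      by (simp only: left_diff_distrib)
  qed
  moreover have "2 * (real (card G) * z) \<le> real K * z"
    using mult_right_mono[OF half z0] by simp
  moreover have "real (card L) * z \<ge> 0"
    using z0 by simp
  moreover have "real (card G) * (2 * b) \<le> 6"
    using cardG by argo
  \<comment> \<open>By \<open>yz\<close>, half the pay on \<open>L\<close> is at most
    \<open>real K * z / 2\<close>; by \<open>half\<close>, so is \<open>real (card G) * z\<close>.
    The shirkers' term \<open>- real K * z\<close> absorbs both, leaving 6.\<close>
  ultimately show ?thesis
    using yz split[of y] split[of "\<lambda>t. b * type_reward t - y t"] by argo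
qed

text \<open>The chosen actions split the types into workers and shirkers; \<open>work\<close> is the
  workers' incentive constraint against action 0.\<close>

lemma opt_single_gap_problem_le:
  assumes K: "K > 0"
  shows "opt_single (gap_problem K) \<le> 12 / real K"
  unfolding opt_single_def
proof (rule cSUP_least)
  show "{x. contract (gap_problem K) x} \<noteq> {}"
    by (auto simp: contract_def intro: exI[of _ "\<lambda>_. 0"])
next
  fix x assume "x \<in> {x. contract (gap_problem K) x}"
  then have x0: "x j \<ge> 0" if "j \<le> K" for j
    using that by (simp add: contract_def)
  define P where "P = gap_problem K"
  define S where "S = {t\<in>{..<K}. chosen_action P t x = 1}"
  define b where "b = 1 - x K / (2 * real K)"
  define z where "z = (\<Sum>j<K. x j) / real K"
  define y where "y t = (1 - type_reward t / (2 * real K)) * x t" for t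
  have S: "S \<subseteq> {..<K}"
    by (auto simp: S_def)
  have y0: "y t \<ge> 0" and yx: "y t \<le> x t" if "t < K" for t
    using x0[of t] that work_prob_bounds[OF K, of t]
    by (auto simp: y_def intro: mult_left_le_one_le)
  have sumx: "(\<Sum>j<K. x j) = real K * z"
    using K by (simp add: z_def)
  have "(\<Sum>t<K. profit P t x) =
      (\<Sum>t\<in>S. b * type_reward t - y t) + (\<Sum>t\<in>{..<K} - S. - z)"
  proof -
    have "(\<Sum>t<K. profit P t x) = (\<Sum>t\<in>S. profit P t x) + (\<Sum>t\<in>{..<K} - S. profit P t x)"
      using sum.subset_diff[OF S, of "\<lambda>t. profit P t x"] by simp
    moreover have "(\<Sum>t\<in>S. profit P t x) = (\<Sum>t\<in>S. b * type_reward t - y t)"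
      by (intro sum.cong)
        (auto simp: profit_def S_def P_def principal_payoff_gap_problem b_def y_def)
    moreover have "(\<Sum>t\<in>{..<K} - S. profit P t x) = (\<Sum>t\<in>{..<K} - S. - z)"
      by (intro sum.cong) (auto simp: profit_def S_def P_def principal_payoff_gap_problem z_def)
    ultimately show ?thesis
      by simp
  qed
  also have "\<dots> = (\<Sum>t\<in>S. b * type_reward t - y t) - real (card ({..<K} - S)) * z"
    by simp
  also have "\<dots> \<le> 12"
  proof (rule single_total_le[OF K S])
    show "z \<ge> 0"
      using x0 by (auto simp: z_def intro!: divide_nonneg_nonneg sum_nonneg)
    have "(\<Sum>t\<in>S. y t) \<le> (\<Sum>t<K. y t)"
      using S y0 by (intro sum_mono2) auto
    also have "\<dots> \<le> (\<Sum>t<K. x t)"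
      using yx by (intro sum_mono) auto
    finally show "(\<Sum>t\<in>S. y t) \<le> real K * z"
      by (simp add: sumx)
  next
    fix t assume t: "t \<in> S"
    then have tK: "t < K"
      by (simp add: S_def)
    then show "y t \<ge> 0"
      by (rule y0)
    have "1 \<in> best_responses P t x"
      using chosen_action[OF principal_agent_problem_gap_problem[OF K], of t x] t
      by (simp add: S_def P_def is_arg_max_def)
    then have "agent_utility P t x 1 \<ge> agent_utility P t x 0"
      by (auto simp: best_responses_def is_arg_max_linorder P_def)
    then have "type_reward t / (2 * real K) * x K + y t - 1 \<ge> z"
      using tK by (simp add: P_def agent_utility_gap_problem y_def z_def)
    moreover have "type_reward t / (2 * real K) * x K = type_reward t - b * type_reward t"
      by (simp add: b_def algebra_simps)
    ultimately show "y t \<ge> z + b * type_reward t - 1 / (real t + 1)"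
      by (simp add: type_reward_def)
  qed
  finally show "expect_type (gap_problem K) (\<lambda>t. profit (gap_problem K) t x) \<le> 12 / real K"
    using K by (simp add: expect_type_def P_def divide_right_mono)
qed

lemma opt_single_gap_problem_pos:
  assumes K: "K > 0"
  shows "opt_single (gap_problem K) > 0"
proof -
  define P where "P = gap_problem K"
  \<comment> \<open>Half of the reward is paid out. Type 0 has \<open>type_reward 0 = 2\<close>, so
    this pay exactly covers the cost of working, and shirkers receive nothing.\<close>
  define x where "x j = (if j = K then real K else 0)" for j
  have P: "principal_agent_problem P"
    unfolding P_def by (rule principal_agent_problem_gap_problem[OF K])
  have payoff: "principal_payoff P t x i = (if i = 1 then type_reward t / 2 else 0)" if "t < K" for t i
    using that by (simp add: P_def principal_payoff_gap_problem x_def)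
  have nonneg: "profit P t x \<ge> 0" if "t < K" for t
    using payoff[OF that] type_reward_bounds(1)[of t] by (simp add: profit_def)
  have "1 \<in> best_responses P 0 x"
    using K by (auto simp: best_responses_def is_arg_max_linorder P_def agent_utility_gap_problem x_def
        type_reward_def)
  from principal_payoff_le_profit[OF P this] have "profit P 0 x > 0"
    using payoff[of 0] K by (simp add: type_reward_def)
  then have "0 < (\<Sum>t<K. profit P t x)"
    using nonneg K by (intro sum_pos2[of _ 0]) auto
  then have "0 < expect_type P (\<lambda>t. profit P t x)"
    using K by (simp add: expect_type_def P_def)
  also have "\<dots> \<le> opt_single P"
    unfolding opt_single_def
    by (intro cSUP_upper bdd_above_single P) (simp add: contract_def x_def)
  finally show ?thesis
    by (simp add: P_def)
qed

section \<open>Menus: lower bound\<close>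

lemma opt_menu_gap_problem_ge:
  assumes K: "K \<ge> 4"
  shows "opt_menu (gap_problem K) \<ge> (harm K - 4) / real K"
proof -
  define P where "P = gap_problem K"
  \<comment> \<open>Solves \<open>p * (1 - 1 / real K) - 1 = p / real K\<close>: even at the largest
    chance of missing outcome \<open>t\<close>, working is as good as shirking.\<close>
  define p where "p = real K / (real K - 2)"
  define X where "X t j = (if j = t \<and> t < K then p else 0)" for t j :: nat
  have p: "p > 0" "p \<le> 1 + 4 / real K" "p - 2 * p / real K = 1"
    using K by (auto simp: p_def divide_simps) (auto simp: algebra_simps)
  have P: "principal_agent_problem P"
    unfolding P_def using K by (intro principal_agent_problem_gap_problem) simp
  have sumX: "(\<Sum>j<K. X t j) = p" if "t < K" for t
    using that by (simp add: X_def)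
  have prob: "type_reward t / (2 * real K) * p \<le> p / real K"
    "type_reward t / (2 * real K) * p \<ge> 0" "type_reward t / (2 * real K) \<le> 1" for t
    using work_prob_bounds[of K t] K p mult_right_mono[of "type_reward t / (2 * real K)" "1 / real K" p]
      type_reward_bounds(1)[of t]
    by auto
  have "ic_menu P X"
  proof -
    \<comment> \<open>Incentive compatibility holds action by action: shirking earns
      \<open>p / real K\<close> under every contract, and working is paid only under the own
      one.\<close>
    have "agent_utility P t (X t') i \<le> agent_utility P t (X t) i" if "t < K" "t' < K" for t t' i
      using that sumX[OF that(1)] sumX[OF that(2)] prob[of t] p
      by (auto simp: P_def agent_utility_gap_problem X_def)
    then have "agent_utility P t (X t') i \<le> (MAX i\<in>{..<n_actions P}. agent_utility P t (X t) i)"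
      if "t < K" "t' < K" "i < n_actions P" for t t' i
      using that by (intro order_trans[OF _ Max_ge[OF _ imageI]]) auto
    then have "incentive_compatible P X"
      unfolding incentive_compatible_def by (auto simp: P_def lessThan_empty_iff intro!: Max.boundedI)
    then show ?thesis
      using p by (auto simp: ic_menu_def contract_def X_def)
  qed
  then have upper: "expect_type P (\<lambda>t. profit P t (X t)) \<le> opt_menu P"
    unfolding opt_menu_def by (intro cSUP_upper bdd_above_menu P) simp
  have "1 / (real t + 1) - 4 / real K \<le> profit P t (X t)" if t: "t < K" for t
  proof -
    have "agent_utility P t (X t) i \<le> agent_utility P t (X t) 1" for i
      using t sumX[OF t] prob[of t] p by (auto simp: P_def agent_utility_gap_problem X_def algebra_simps)
    then have "1 \<in> best_responses P t (X t)"
      by (auto simp: best_responses_def is_arg_max_linorder P_def)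
    from principal_payoff_le_profit[OF P this]
    have "type_reward t - (1 - type_reward t / (2 * real K)) * p \<le> profit P t (X t)"
      using t by (simp add: P_def principal_payoff_gap_problem X_def)
    moreover have "(1 - type_reward t / (2 * real K)) * p = p - type_reward t / (2 * real K) * p"
      by (simp add: left_diff_distrib)
    ultimately show ?thesis
      using prob(2)[of t] p(2) by (simp only: type_reward_def)
  qed
  then have "(\<Sum>t<K. 1 / (real t + 1) - 4 / real K) \<le> (\<Sum>t<K. profit P t (X t))"
    by (intro sum_mono) auto
  moreover have "(\<Sum>t<K. 1 / (real t + 1)) = harm K"
    unfolding harm_def by (rule sum.reindex_bij_witness[of _ "\<lambda>k. k - 1" Suc]) (auto simp: divide_simps)
  ultimately have "harm K - 4 \<le> (\<Sum>t<K. profit P t (X t))"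
    using K by (simp add: sum_subtractf)
  then have "(harm K - 4) / real K \<le> expect_type P (\<lambda>t. profit P t (X t))"
    by (simp add: expect_type_def P_def divide_right_mono)
  with upper show ?thesis
    by (simp add: P_def)
qed

theorem lemma20:
  fixes \<epsilon> :: real
  assumes "\<epsilon> > 0"
  shows "\<exists>P. principal_agent_problem P \<and> n_actions P = 3 \<and>
           opt_single P > 0 \<and> opt_menu P / opt_single P \<ge> 2 - \<epsilon>"
proof -
  \<comment> \<open>The harmonic numbers diverge; 28 makes \<open>harm K - 4\<close> at least twice
    the bound 12 for single contracts.\<close>
  have "eventually (\<lambda>K. harm K \<ge> (28::real) \<and> K \<ge> 4) sequentially"
    using harm_at_top by (intro eventually_conj eventually_ge_at_top) (simp add: filterlim_at_top)
  then obtain K where harm: "harm K \<ge> (28::real)" and K: "K \<ge> 4"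
    by (metis (no_types, lifting) eventually_happens' sequentially_bot)
  have K0: "K > 0"
    using K by simp
  have "2 * opt_single (gap_problem K) \<le> 24 / real K"
    using opt_single_gap_problem_le[OF K0] by simp
  also have "\<dots> \<le> (harm K - 4) / real K"
    using harm by (intro divide_right_mono) auto
  also have "\<dots> \<le> opt_menu (gap_problem K)"
    by (rule opt_menu_gap_problem_ge[OF K])
  finally have "2 \<le> opt_menu (gap_problem K) / opt_single (gap_problem K)"
    using opt_single_gap_problem_pos[OF K0] by (simp add: pos_le_divide_eq)
  then show ?thesis
    using assms principal_agent_problem_gap_problem[OF K0] opt_single_gap_problem_pos[OF K0]
    by (intro exI[of _ "gap_problem K"]) auto
qed

end
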